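(* Let $K$ be a field of characteristic $0$ and let $F=(F_1,\dots,F_n):K^n\to K^n$ be a polynomial map of the form $$F_i(X_1,\dots,X_n)=X_i+H_i(X_1,\dots,X_n),\qquad i=1,\dots,n,$$ where $H_i\in K[X_1,\dots,X_n]$ is a polynomial of degree $D_i$ and lower degree $d_i$, with $d_i\ge 2$, for $i=1,\dots,n$. Let $d=\min_i d_i$ and $D=\max_i D_i$. For each $i$ let $(P^i_k)_{k\ge 0}$ be the polynomial sequence defined by $P^i_0=X_i$ and $P^i_k(X)=P^i_{k-1}(F_1,\dots,F_n)-P^i_{k-1}(X_1,\dots,X_n)$ for $k\ge 1$. The following conditions are equivalent: 1) $F$ is invertible. 2) For $i=1,\dots,n$ there is a polynomial $G_i(X)\in K[X_1,\dots,X_n]$ of degree $\le D^{n-1}$, independent of $m$, such that for every integer $m>\frac{D^{n-1}-d_i}{d-1}+1$ we have $$\sum_{j=0}^{m-1}(-1)^jP^i_j(X)=G_i(X)+R^i_m(X),$$ where $R^i_m(X)$ is a polynomial satisfying $R^i_m(F)=(-1)^{m+1}P^i_m(X)$ (with lower degree $\ge (m-1)(d-1)+d_i>D^{n-1}$). 3) For $i=1,\dots,n$ and $m=\left\lfloor \frac{D^{n-1}-d_i}{d-1}+1\right\rfloor+1$ we have $$\sum_{j=0}^{m-1}(-1)^jP^i_j(X)=G_i(X)+R^i_m(X),$$ where $G_i(X)$ is a polynomial of degree $\le D^{n-1}$ and $R^i_m(X)$ is a polynomial satisfying $R^i_m(F)=(-1)^{m+1}P^i_m(X)$. Moreover, when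 $F$ is invertible, its inverse $G=(G_1,\dots,G_n)$ is given by $$G_i(Y_1,\dots,Y_n)=\sum_{l=0}^{m-1}(-1)^l\tilde P^i_l(Y_1,\dots,Y_n),\qquad i=1,\dots,n,$$ where $\tilde P^i_l$ is the sum of the homogeneous summands of $P^i_l$ of degree $\le D^{n-1}$ and $m$ is any integer $>\frac{D^{n-1}-d_i}{d-1}+1$.
   Context: $X=(X_1,\dots,X_n)$. A polynomial map $F=(F_1,\dots,F_n):K^n\to K^n$ is a map given by polynomials $F_i\in K[X_1,\dots,X_n]$; for $Q\in K[X_1,\dots,X_n]$, $Q(F)=Q(F_1,\dots,F_n)$ denotes substitution. $F$ is invertible if there exists a polynomial map $G=(G_1,\dots,G_n):K^n\to K^n$ such that $X_i=G_i(F_1,\dots,F_n)$ for $1\le i\le n$; $G$ is then the inverse of $F$. The degree (resp. lower degree) of a nonzero polynomial is the largest (resp. smallest) degree of its nonzero homogeneous summands. Inequalities "degree $\le a$" and "lower degree $\ge b$" are understood to hold for the zero polynomial. *)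

theory Defs
  imports Complex_Main "HOL-Library.Poly_Mapping" "HOL-Library.Cardinality"
begin

text \<open>Polynomials over \<open>'k\<close> in the variables \<open>X i\<close> with \<open>i :: 'n\<close>, for a finite type \<open>'n\<close>, so that
  the number of variables is \<open>CARD('n)\<close>: a finitely supported coefficient function on exponent
  vectors, with the convolution product of \<^theory>\<open>HOL-Library.Poly_Mapping\<close>.\<close>

type_synonym ('n, 'k) mpoly = "('n \<Rightarrow>\<^sub>0 nat) \<Rightarrow>\<^sub>0 'k"

definition Const :: "'k::zero \<Rightarrow> ('n, 'k) mpoly"
  where "Const c = Poly_Mapping.single 0 c"

definition X :: "'n \<Rightarrow> ('n, 'k::zero_neq_one) mpoly"
  where "X i = Poly_Mapping.single (Poly_Mapping.single i 1) 1"

definition monom_degree :: "('n::finite \<Rightarrow>\<^sub>0 nat) \<Rightarrow> nat"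
  where "monom_degree a = (\<Sum>i\<in>UNIV. Poly_Mapping.lookup a i)"

definition hom_summand :: "nat \<Rightarrow> ('n::finite, 'k::comm_monoid_add) mpoly \<Rightarrow> ('n, 'k) mpoly"
  where "hom_summand k p =
    (\<Sum>a | a \<in> Poly_Mapping.keys p \<and> monom_degree a = k.
       Poly_Mapping.single a (Poly_Mapping.lookup p a))"

text \<open>The degree and the lower degree are meaningful for nonzero polynomials only; on \<open>0\<close> they are
  unspecified values, so bounds on them are stated through the two predicates below.\<close>

definition total_degree :: "('n::finite, 'k::comm_monoid_add) mpoly \<Rightarrow> nat"
  where "total_degree p = Max {k. hom_summand k p \<noteq> 0}"

definition lower_degree :: "('n::finite, 'k::comm_monoid_add) mpoly \<Rightarrow> nat"
  where "lower_degree p = Min {k. hom_summand k p \<noteq> 0}"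

definition degree_le :: "('n::finite, 'k::comm_monoid_add) mpoly \<Rightarrow> nat \<Rightarrow> bool"
  where "degree_le p b \<longleftrightarrow> p = 0 \<or> total_degree p \<le> b"

definition lower_degree_ge :: "('n::finite, 'k::comm_monoid_add) mpoly \<Rightarrow> nat \<Rightarrow> bool"
  where "lower_degree_ge p b \<longleftrightarrow> p = 0 \<or> b \<le> lower_degree p"

definition truncate_degree :: "nat \<Rightarrow> ('n::finite, 'k::comm_monoid_add) mpoly \<Rightarrow> ('n, 'k) mpoly"
  where "truncate_degree b p = (\<Sum>k\<le>b. hom_summand k p)"

text \<open>\<open>subst_poly Q F\<close> is the substitution \<open>Q(F)\<close>. A polynomial map is the tuple
  \<open>F :: 'n \<Rightarrow> ('n, 'k) mpoly\<close> of its components.\<close>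

definition subst_poly ::
    "('n::finite, 'k::comm_ring_1) mpoly \<Rightarrow> ('n \<Rightarrow> ('n, 'k) mpoly) \<Rightarrow> ('n, 'k) mpoly"
  where "subst_poly Q F =
    (\<Sum>a\<in>Poly_Mapping.keys Q.
       Const (Poly_Mapping.lookup Q a) * (\<Prod>i\<in>UNIV. F i ^ Poly_Mapping.lookup a i))"

definition is_inverse ::
    "('n::finite \<Rightarrow> ('n, 'k::comm_ring_1) mpoly) \<Rightarrow> ('n \<Rightarrow> ('n, 'k) mpoly) \<Rightarrow> bool"
  where "is_inverse F G \<longleftrightarrow> (\<forall>i. X i = subst_poly (G i) F)"

definition invertible_map :: "('n::finite \<Rightarrow> ('n, 'k::comm_ring_1) mpoly) \<Rightarrow> bool"
  where "invertible_map F \<longleftrightarrow> (\<exists>G. is_inverse F G)"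

primrec P_seq ::
    "('n::finite \<Rightarrow> ('n, 'k::comm_ring_1) mpoly) \<Rightarrow> 'n \<Rightarrow> nat \<Rightarrow> ('n, 'k) mpoly"
  where
    "P_seq F i 0 = X i"
  | "P_seq F i (Suc k) = subst_poly (P_seq F i k) F - P_seq F i k"

end

theory Submission
  imports Defs "HOL-Library.Countable" "HOL-Library.FuncSet"
begin

text \<open>Let \<open>\<sigma>\<close> be the substitution of \<open>F\<close> and \<open>\<Delta> = \<sigma> - 1\<close>, so that \<open>P_seq F i k = \<Delta>\<^sup>k (X i)\<close>. The
  alternating sums are partial sums of the geometric series of \<open>(1 + \<Delta>)\<^sup>-\<^sup>1 = \<sigma>\<^sup>-\<^sup>1\<close>, and \<open>\<Delta>\<close> raises
  the lower degree by \<open>d - 1\<close>; hence \<open>\<sigma>\<close> is injective, and if \<open>F\<close> has an inverse \<open>G\<close>, then the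
  remainders \<open>R m\<close> of these sums satisfy \<open>R (m + 1) = - \<Delta> (R m)\<close> and have large lower degree.

  What remains is the bound \<open>deg G \<le> D\<^bsup>n-1\<^esup>\<close>, obtained by counting dimensions. Let \<open>a\<close>, of degree \<open>e\<close>,
  be the leading exponent of \<open>G i\<close>. For exponents \<open>b\<close> not divisible by \<open>a\<close>, the products
  \<open>X\<^sup>b (G i)\<^sup>l\<close> have distinct leading exponents \<open>b + l a\<close>, so their images \<open>F\<^sup>b (X i)\<^sup>l\<close> under \<open>\<sigma>\<close>, of
  degree at most \<open>D |b| + l\<close>, are linearly independent. With \<open>A s\<close> the number of exponents of degree
  at most \<open>s\<close>, this gives \<open>D e A s \<le> A (D (s + e)) \<le> D\<^sup>n A (s + e)\<close>; as \<open>A\<close> grows only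
  polynomially, \<open>D e \<le> D\<^sup>n\<close>.\<close>

section \<open>Degrees and substitution\<close>

lemma monom_degree_add: "monom_degree (a + b) = monom_degree a + monom_degree b"
  by (simp add: monom_degree_def lookup_add sum.distrib)

lemma monom_degree_zero [simp]: "monom_degree 0 = 0"
  by (simp add: monom_degree_def)

lemma monom_degree_single [simp]: "monom_degree (Poly_Mapping.single i k) = k"
  by (simp add: monom_degree_def lookup_single when_def)

lemma monom_degree_pos_iff: "0 < monom_degree a \<longleftrightarrow> a \<noteq> 0"
proof -
  have "monom_degree a = 0 \<longleftrightarrow> a = 0"
    by (auto simp: monom_degree_def poly_mapping_eq_iff fun_eq_iff)
  then show ?thesis by (metis neq0_conv)
qed

lemma poly_mapping_sum_single:
  "(\<Sum>a\<in>Poly_Mapping.keys p. Poly_Mapping.single a (Poly_Mapping.lookup p a)) = p"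
  by (rule poly_mapping_eqI)
     (auto simp: lookup_sum lookup_single when_def in_keys_iff sum.delta)

lemma lookup_hom_summand:
  "Poly_Mapping.lookup (hom_summand k p) a = (Poly_Mapping.lookup p a when monom_degree a = k)"
proof -
  have "finite {a \<in> Poly_Mapping.keys p. monom_degree a = k}"
    by simp
  then show ?thesis
    by (auto simp: hom_summand_def lookup_sum lookup_single when_def in_keys_iff sum.delta)
qed

text \<open>Turns the degree and lower degree into extrema of a finite set of monomial degrees, so
  that bounds on them become conditions on each exponent.\<close>

lemma hom_summands_nonzero:
  "{k. hom_summand k p \<noteq> 0} = monom_degree ` Poly_Mapping.keys p"
  by (auto simp: poly_mapping_eq_iff fun_eq_iff lookup_hom_summand in_keys_iff image_iff)

lemma degree_le_iff: "degree_le p b \<longleftrightarrow> (\<forall>a\<in>Poly_Mapping.keys p. monom_degree a \<le> b)"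
proof (cases "p = 0")
  case False
  then have "Poly_Mapping.keys p \<noteq> {}" by simp
  with False show ?thesis
    by (simp add: degree_le_def total_degree_def hom_summands_nonzero)
qed (simp add: degree_le_def)

lemma lower_degree_ge_iff:
  "lower_degree_ge p b \<longleftrightarrow> (\<forall>a\<in>Poly_Mapping.keys p. b \<le> monom_degree a)"
proof (cases "p = 0")
  case False
  then have "Poly_Mapping.keys p \<noteq> {}" by simp
  with False show ?thesis
    by (simp add: lower_degree_ge_def lower_degree_def hom_summands_nonzero)
qed (simp add: lower_degree_ge_def)

lemma lookup_truncate_degree:
  "Poly_Mapping.lookup (truncate_degree b p) a =
    (Poly_Mapping.lookup p a when monom_degree a \<le> b)"
  by (auto simp: truncate_degree_def lookup_sum lookup_hom_summand when_def sum.delta)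

lemma Const_mult: "Const (a * b) = (Const a * Const b :: ('n, 'k::comm_ring_1) mpoly)"
  by (simp add: Const_def mult_single)

lemma degree_le_add: "degree_le p b \<Longrightarrow> degree_le q b \<Longrightarrow> degree_le (p + q) b"
  unfolding degree_le_iff using keys_add[of p q] by (auto dest!: subsetD)

lemma degree_le_mult: "degree_le p b \<Longrightarrow> degree_le q c \<Longrightarrow> degree_le (p * q) (b + c)"
  unfolding degree_le_iff using keys_mult[of p q]
  by (auto dest!: subsetD simp: monom_degree_add add_mono)

lemma degree_le_mono: "degree_le p b \<Longrightarrow> b \<le> c \<Longrightarrow> degree_le p c"
  by (auto simp: degree_le_def)

lemma degree_le_one [simp]: "degree_le 1 b"
  by (simp add: degree_le_iff)

lemma degree_le_X: "degree_le (X i) 1"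
  by (simp add: degree_le_iff X_def)

lemma degree_le_power: "degree_le p b \<Longrightarrow> degree_le (p ^ k) (k * b)"
  by (induction k) (auto intro: degree_le_mult)

lemma degree_le_prod:
  assumes "\<And>i. i \<in> A \<Longrightarrow> degree_le (f i) (b i)"
  shows "degree_le (\<Prod>i\<in>A. f i) (\<Sum>i\<in>A. b i)"
  using assms by (induction A rule: infinite_finite_induct) (auto intro: degree_le_mult)

lemma lower_degree_ge_zero [simp]: "lower_degree_ge 0 b"
  by (simp add: lower_degree_ge_def)

lemma lower_degree_ge_0 [simp]: "lower_degree_ge p 0"
  by (simp add: lower_degree_ge_def)

lemma lower_degree_ge_mono: "lower_degree_ge p b \<Longrightarrow> c \<le> b \<Longrightarrow> lower_degree_ge p c"
  by (auto simp: lower_degree_ge_def)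

lemma lower_degree_ge_add:
  "lower_degree_ge p b \<Longrightarrow> lower_degree_ge q b \<Longrightarrow> lower_degree_ge (p + q) b"
  unfolding lower_degree_ge_iff using keys_add[of p q] by (auto dest!: subsetD)

lemma lower_degree_ge_uminus:
  fixes p :: "('n::finite, 'k::ab_group_add) mpoly"
  shows "lower_degree_ge p b \<Longrightarrow> lower_degree_ge (- p) b"
  by (simp add: lower_degree_ge_iff in_keys_iff)

lemma lower_degree_ge_mult:
  "lower_degree_ge p b \<Longrightarrow> lower_degree_ge q c \<Longrightarrow> lower_degree_ge (p * q) (b + c)"
  unfolding lower_degree_ge_iff using keys_mult[of p q]
  by (auto dest!: subsetD simp: monom_degree_add add_mono)

lemma lower_degree_ge_sum:
  "(\<And>x. x \<in> A \<Longrightarrow> lower_degree_ge (f x) b) \<Longrightarrow> lower_degree_ge (\<Sum>x\<in>A. f x) b"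
  by (induction A rule: infinite_finite_induct) (auto intro: lower_degree_ge_add)

lemma lower_degree_ge_power: "lower_degree_ge p b \<Longrightarrow> lower_degree_ge (p ^ k) (k * b)"
  by (induction k) (auto intro: lower_degree_ge_mult)

lemma lower_degree_ge_prod:
  assumes "\<And>i. i \<in> A \<Longrightarrow> lower_degree_ge (f i) (b i)"
  shows "lower_degree_ge (\<Prod>i\<in>A. f i) (\<Sum>i\<in>A. b i)"
  using assms by (induction A rule: infinite_finite_induct) (auto intro: lower_degree_ge_mult)

lemma lower_degree_ge_X: "lower_degree_ge (X i) 1"
  by (simp add: lower_degree_ge_iff X_def)

section \<open>Substitution as a ring homomorphism\<close>

definition monomial_at ::
    "('n::finite \<Rightarrow> ('n, 'k::comm_ring_1) mpoly) \<Rightarrow> ('n \<Rightarrow>\<^sub>0 nat) \<Rightarrow> ('n, 'k) mpoly"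
  where "monomial_at F a = (\<Prod>i\<in>UNIV. F i ^ Poly_Mapping.lookup a i)"

lemma monomial_at_add: "monomial_at F (a + b) = monomial_at F a * monomial_at F b"
  by (simp add: monomial_at_def lookup_add power_add prod.distrib)

lemma monomial_at_zero [simp]: "monomial_at F 0 = 1"
  by (simp add: monomial_at_def)

lemma monomial_at_single: "monomial_at F (Poly_Mapping.single i k) = F i ^ k"
proof -
  have "F j ^ (k when i = j) = (if j = i then F i ^ k else 1)" for j
    by simp
  then show ?thesis
    by (simp add: monomial_at_def lookup_single prod.delta)
qed

lemma degree_le_monomial_at:
  assumes "\<And>i. degree_le (F i) b"
  shows "degree_le (monomial_at F a) (b * monom_degree a)"
proof -
  have "degree_le (\<Prod>i\<in>UNIV. F i ^ Poly_Mapping.lookup a i) (\<Sum>i\<in>UNIV. Poly_Mapping.lookup a i * b)"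
    by (intro degree_le_prod degree_le_power assms)
  then show ?thesis
    by (simp add: monomial_at_def monom_degree_def sum_distrib_left mult.commute)
qed

lemma lower_degree_ge_monomial_at:
  assumes "\<And>i. lower_degree_ge (F i) 1"
  shows "lower_degree_ge (monomial_at F a) (monom_degree a)"
proof -
  have "lower_degree_ge (\<Prod>i\<in>UNIV. F i ^ Poly_Mapping.lookup a i)
      (\<Sum>i\<in>UNIV. Poly_Mapping.lookup a i * 1)"
    by (intro lower_degree_ge_prod lower_degree_ge_power assms)
  then show ?thesis
    by (simp add: monomial_at_def monom_degree_def)
qed

lemma X_power: "X i ^ k = (Poly_Mapping.single (Poly_Mapping.single i k) 1
    :: ('n, 'k::comm_ring_1) mpoly)"
  by (induction k) (simp_all add: X_def mult_single flip: single_add)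

lemma prod_single_one:
  "(\<Prod>i\<in>A. Poly_Mapping.single (f i) (1::'k::comm_ring_1)) = Poly_Mapping.single (\<Sum>i\<in>A. f i :: _::comm_monoid_add) 1"
  by (induction A rule: infinite_finite_induct) (simp_all add: mult_single)

lemma monomial_at_X: "monomial_at X a = Poly_Mapping.single a (1::'k::comm_ring_1)"
proof -
  have "(\<Sum>i\<in>UNIV. Poly_Mapping.single i (Poly_Mapping.lookup a i)) = a"
    by (rule poly_mapping_eqI) (simp add: lookup_sum lookup_single when_def sum.delta)
  then show ?thesis
    by (simp add: monomial_at_def X_power prod_single_one)
qed

text \<open>Extra exponents contribute 0. A common index set for two polynomials is what additivity
  requires.\<close>

lemma subst_poly_eq_sum:
  assumes "finite A" "Poly_Mapping.keys Q \<subseteq> A"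
  shows "subst_poly Q F = (\<Sum>a\<in>A. Const (Poly_Mapping.lookup Q a) * monomial_at F a)"
  unfolding subst_poly_def monomial_at_def using assms
  by (intro sum.mono_neutral_left) (auto simp: in_keys_iff Const_def)

lemma subst_poly_single: "subst_poly (Poly_Mapping.single a c) F = Const c * monomial_at F a"
  by (subst subst_poly_eq_sum[of "{a}"]) auto

lemma subst_poly_zero [simp]: "subst_poly 0 F = 0"
  by (simp add: subst_poly_def)

lemma subst_poly_add: "subst_poly (P + Q) F = subst_poly P F + subst_poly Q F"
  using keys_add[of P Q]
  by (simp add: subst_poly_eq_sum[of "Poly_Mapping.keys P \<union> Poly_Mapping.keys Q"]
      lookup_add Const_def single_add distrib_right sum.distrib)

lemma subst_poly_uminus: "subst_poly (- P) F = - subst_poly P F"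
  using subst_poly_add[of P "- P" F] by (simp add: eq_neg_iff_add_eq_0 add.commute)

lemma subst_poly_diff: "subst_poly (P - Q) F = subst_poly P F - subst_poly Q F"
  using subst_poly_add[of P "- Q" F] by (simp add: subst_poly_uminus)

lemma subst_poly_sum: "subst_poly (\<Sum>x\<in>A. f x) F = (\<Sum>x\<in>A. subst_poly (f x) F)"
  by (induction A rule: infinite_finite_induct) (simp_all add: subst_poly_add)

text \<open>Both sides are biadditive in P and Q, which reduces the claim to single terms and
  \<open>monomial_at_add\<close>.\<close>

lemma subst_poly_mult: "subst_poly (P * Q) F = subst_poly P F * subst_poly Q F"
proof -
  let ?s = "\<lambda>P a. Poly_Mapping.single a (Poly_Mapping.lookup P a)"
  have monomials: "subst_poly (?s P a * ?s Q b) F = subst_poly (?s P a) F * subst_poly (?s Q b) F"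
    for a b
    by (simp add: mult_single subst_poly_single monomial_at_add Const_mult ac_simps)
  have "subst_poly ((\<Sum>a\<in>Poly_Mapping.keys P. ?s P a) * (\<Sum>b\<in>Poly_Mapping.keys Q. ?s Q b)) F =
    subst_poly (\<Sum>a\<in>Poly_Mapping.keys P. ?s P a) F * subst_poly (\<Sum>b\<in>Poly_Mapping.keys Q. ?s Q b) F"
    by (simp only: subst_poly_sum sum_product monomials)
  then show ?thesis
    by (simp only: poly_mapping_sum_single)
qed

lemma subst_poly_Const [simp]: "subst_poly (Const c) F = Const c"
  unfolding Const_def by (simp add: subst_poly_single Const_def)

lemma subst_poly_one [simp]: "subst_poly 1 F = 1"
  using subst_poly_Const[of 1 F] by (simp add: Const_def)

lemma subst_poly_X [simp]: "subst_poly (X i) F = F i"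
  by (simp add: X_def subst_poly_single monomial_at_single Const_def)

lemma subst_poly_power: "subst_poly (P ^ k) F = subst_poly P F ^ k"
  by (induction k) (simp_all add: subst_poly_mult)

lemma subst_poly_prod: "subst_poly (\<Prod>x\<in>A. f x) F = (\<Prod>x\<in>A. subst_poly (f x) F)"
  by (induction A rule: infinite_finite_induct) (simp_all add: subst_poly_mult)

lemma subst_poly_monomial_at:
  "subst_poly (monomial_at G a) F = monomial_at (\<lambda>i. subst_poly (G i) F) a"
  by (simp add: monomial_at_def subst_poly_prod subst_poly_power)

lemma subst_poly_subst_poly:
  "subst_poly (subst_poly Q G) F = subst_poly Q (\<lambda>i. subst_poly (G i) F)"
  by (simp add: subst_poly_eq_sum[of "Poly_Mapping.keys Q"] subst_poly_sum subst_poly_mult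
      subst_poly_monomial_at)

lemma subst_poly_id [simp]: "subst_poly Q X = Q"
proof -
  have "subst_poly Q X = (\<Sum>a\<in>Poly_Mapping.keys Q. Poly_Mapping.single a (Poly_Mapping.lookup Q a))"
    by (simp add: subst_poly_eq_sum[of "Poly_Mapping.keys Q"] monomial_at_X Const_def mult_single)
  then show ?thesis by (simp add: poly_mapping_sum_single)
qed

section \<open>Effect of substitution on the lower degree\<close>

lemma lower_degree_ge_subst_poly:
  assumes "\<And>i. lower_degree_ge (G i) 1" "lower_degree_ge Q b"
  shows "lower_degree_ge (subst_poly Q G) b"
proof -
  have "lower_degree_ge (Const c * monomial_at G a) (0 + monom_degree a)" for a c
    by (intro lower_degree_ge_mult lower_degree_ge_0 lower_degree_ge_monomial_at assms)
  with assms(2) show ?thesis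
    by (auto simp: subst_poly_eq_sum[of "Poly_Mapping.keys Q"] lower_degree_ge_iff[of Q]
        intro!: lower_degree_ge_sum intro: lower_degree_ge_mono)
qed

text \<open>A product rule, to be applied to the factors \<open>F i \<equiv> X i\<close> (modulo terms of degree at least
  \<open>1 + \<delta>\<close>) of a monomial evaluated at \<open>F\<close>.\<close>

lemma lower_degree_ge_diff_mult:
  fixes f g x y :: "('n::finite, 'k::comm_ring_1) mpoly"
  assumes "lower_degree_ge f s" "lower_degree_ge (f - x) (s + \<delta>)"
    and "lower_degree_ge y t" "lower_degree_ge (g - y) (t + \<delta>)"
  shows "lower_degree_ge (f * g - x * y) (s + t + \<delta>)"
proof -
  have "lower_degree_ge ((f - x) * y + f * (g - y)) (s + t + \<delta>)"
    using lower_degree_ge_mult[OF assms(2,3)] lower_degree_ge_mult[OF assms(1,4)]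
    by (intro lower_degree_ge_add) (simp_all add: add_ac)
  then show ?thesis by (simp add: algebra_simps)
qed

lemma lower_degree_ge_diff_power:
  fixes f x :: "('n::finite, 'k::comm_ring_1) mpoly"
  assumes "lower_degree_ge f s" "lower_degree_ge x s" "lower_degree_ge (f - x) (s + \<delta>)"
  shows "lower_degree_ge (f ^ k - x ^ k) (k * s + \<delta>)"
proof (induction k)
  case (Suc k)
  then show ?case
    using lower_degree_ge_diff_mult[OF assms(1,3) lower_degree_ge_power[OF assms(2)]] by simp
qed simp

lemma lower_degree_ge_diff_prod:
  fixes f x :: "'i \<Rightarrow> ('n::finite, 'k::comm_ring_1) mpoly"
  assumes "\<And>i. i \<in> A \<Longrightarrow> lower_degree_ge (f i) (s i)" "\<And>i. i \<in> A \<Longrightarrow> lower_degree_ge (x i) (s i)"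
    and "\<And>i. i \<in> A \<Longrightarrow> lower_degree_ge (f i - x i) (s i + \<delta>)"
  shows "lower_degree_ge ((\<Prod>i\<in>A. f i) - (\<Prod>i\<in>A. x i)) ((\<Sum>i\<in>A. s i) + \<delta>)"
  using assms
proof (induction A rule: infinite_finite_induct)
  case (insert i A)
  then show ?case
    using lower_degree_ge_diff_mult[of "f i" "s i" "x i" \<delta> "prod x A" "sum s A" "prod f A"]
      lower_degree_ge_prod[of A x s]
    by simp
qed simp_all

text \<open>The operator \<Delta> raises the lower degree by \<delta>: on each monomial this is the
  product rule applied to the powers of F i and X i, and it extends linearly to Q.\<close>

lemma lower_degree_ge_subst_poly_diff:
  assumes "\<And>i. lower_degree_ge (F i) 1" "\<And>i. lower_degree_ge (F i - X i) (1 + \<delta>)"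
    and "lower_degree_ge Q s"
  shows "lower_degree_ge (subst_poly Q F - Q) (s + \<delta>)"
proof -
  have "lower_degree_ge (monomial_at F a - monomial_at X a) (monom_degree a + \<delta>)" for a
  proof -
    have *: "lower_degree_ge (F i ^ Poly_Mapping.lookup a i - X i ^ Poly_Mapping.lookup a i)
        (Poly_Mapping.lookup a i + \<delta>)" for i
      using lower_degree_ge_diff_power[OF assms(1) lower_degree_ge_X assms(2)] by simp
    show ?thesis
      unfolding monomial_at_def monom_degree_def
      using lower_degree_ge_power[OF assms(1)] lower_degree_ge_power[OF lower_degree_ge_X] *
      by (intro lower_degree_ge_diff_prod) auto
  qed
  then have *: "lower_degree_ge (Const c * (monomial_at F a - monomial_at X a))
      (0 + (monom_degree a + \<delta>))" for a c
    by (intro lower_degree_ge_mult lower_degree_ge_0)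
  have "lower_degree_ge (\<Sum>a\<in>Poly_Mapping.keys Q.
      Const (Poly_Mapping.lookup Q a) * (monomial_at F a - monomial_at X a)) (s + \<delta>)"
  proof (rule lower_degree_ge_sum)
    fix a assume "a \<in> Poly_Mapping.keys Q"
    with assms(3) have "s + \<delta> \<le> 0 + (monom_degree a + \<delta>)"
      by (simp add: lower_degree_ge_iff)
    then show "lower_degree_ge (Const (Poly_Mapping.lookup Q a) *
        (monomial_at F a - monomial_at X a)) (s + \<delta>)"
      by (rule lower_degree_ge_mono[OF *])
  qed
  moreover have "subst_poly Q F - Q = subst_poly Q F - subst_poly Q X"
    by simp
  ultimately show ?thesis
    by (simp only: subst_poly_eq_sum[of "Poly_Mapping.keys Q"] finite_keys subset_refl
        right_diff_distrib sum_subtractf)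
qed

text \<open>If Q(F) = 0, then Q = -(Q(F) - Q), so a lower degree bound s for Q improves to s + 1. A
  nonzero polynomial cannot satisfy all these bounds.\<close>

lemma subst_poly_eq_0_iff:
  assumes "\<And>i. lower_degree_ge (F i) 1" "\<And>i. lower_degree_ge (F i - X i) 2"
  shows "subst_poly Q F = 0 \<longleftrightarrow> Q = 0"
proof
  assume 0: "subst_poly Q F = 0"
  have "lower_degree_ge Q s" for s
  proof (induction s)
    case (Suc s)
    have "lower_degree_ge (subst_poly Q F - Q) (s + 1)"
      using assms Suc by (intro lower_degree_ge_subst_poly_diff) (simp_all add: numeral_2_eq_2)
    with 0 show ?case
      using lower_degree_ge_uminus[of "- Q"] by simp
  qed simp
  then show "Q = 0"
    unfolding lower_degree_ge_def using not_less_eq_eq by blast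
qed simp

section \<open>Leading exponents\<close>

text \<open>Exponent vectors are compared by total degree first and then lexicographically, through an
  embedding into \<^typ>\<open>nat \<Rightarrow>\<^sub>0 nat\<close>, whose order is lexicographic.\<close>

definition exponent_key :: "('n::finite \<Rightarrow>\<^sub>0 nat) \<Rightarrow> (nat \<Rightarrow>\<^sub>0 nat)"
  where "exponent_key a = Poly_Mapping.single 0 (monom_degree a) +
    (\<Sum>i\<in>UNIV. Poly_Mapping.single (Suc (to_nat i)) (Poly_Mapping.lookup a i))"

lemma lookup_exponent_key_0: "Poly_Mapping.lookup (exponent_key a) 0 = monom_degree a"
  by (simp add: exponent_key_def lookup_add lookup_sum lookup_single)

lemma lookup_exponent_key_Suc:
  "Poly_Mapping.lookup (exponent_key a) (Suc (to_nat i)) = Poly_Mapping.lookup a i"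
  by (simp add: exponent_key_def lookup_add lookup_sum lookup_single when_def sum.delta)

lemma exponent_key_add: "exponent_key (a + b) = exponent_key a + exponent_key b"
  by (simp add: exponent_key_def monom_degree_add single_add lookup_add sum.distrib ac_simps)

lemma exponent_key_inject [simp]: "exponent_key a = exponent_key b \<longleftrightarrow> a = b"
proof
  assume eq: "exponent_key a = exponent_key b"
  have "Poly_Mapping.lookup a i = Poly_Mapping.lookup b i" for i
    using lookup_exponent_key_Suc[of a i] lookup_exponent_key_Suc[of b i] eq by simp
  then show "a = b" by (rule poly_mapping_eqI)
qed simp

text \<open>The degree sits at index 0 of the key, which the lexicographic order compares first: a
  first difference at a later index means equal degrees.\<close>

lemma monom_degree_le_if_key_le:
  fixes a b :: "'n::finite \<Rightarrow>\<^sub>0 nat"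
  assumes "exponent_key a \<le> exponent_key b"
  shows "monom_degree a \<le> monom_degree b"
proof -
  consider "a = b" | "less_fun (Poly_Mapping.lookup (exponent_key a)) (Poly_Mapping.lookup (exponent_key b))"
    using assms by (auto simp: less_eq_poly_mapping.rep_eq lookup_inject)
  then show ?thesis
  proof cases
    case 2
    then obtain k where "Poly_Mapping.lookup (exponent_key a) k < Poly_Mapping.lookup (exponent_key b) k"
      "\<And>k'. k' < k \<Longrightarrow> Poly_Mapping.lookup (exponent_key a) k' = Poly_Mapping.lookup (exponent_key b) k'"
      by (auto simp: less_fun_def)
    then show ?thesis
      by (cases k) (force simp flip: lookup_exponent_key_0)+
  qed simp
qed

definition leading_exponent :: "('n::finite, 'k::zero) mpoly \<Rightarrow> ('n \<Rightarrow>\<^sub>0 nat) \<Rightarrow> bool"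
  where "leading_exponent p a \<longleftrightarrow>
    a \<in> Poly_Mapping.keys p \<and> (\<forall>b\<in>Poly_Mapping.keys p. exponent_key b \<le> exponent_key a)"

lemma finite_maximal_key:
  fixes f :: "'a \<Rightarrow> 'b::linorder"
  assumes "finite A" "A \<noteq> {}"
  obtains m where "m \<in> A" "\<And>y. y \<in> A \<Longrightarrow> f y \<le> f m"
proof -
  have "Max (f ` A) \<in> f ` A"
    using assms by simp
  then obtain m where "m \<in> A" "f m = Max (f ` A)"
    by auto
  with assms(1) show ?thesis
    by (intro that[of m]) auto
qed

lemma leading_exponent_exists:
  assumes "p \<noteq> 0"
  obtains a where "leading_exponent p a"
proof (rule finite_maximal_key[of "Poly_Mapping.keys p" exponent_key])
  fix m assume "m \<in> Poly_Mapping.keys p"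
    "\<And>b. b \<in> Poly_Mapping.keys p \<Longrightarrow> exponent_key b \<le> exponent_key m"
  then show ?thesis
    by (intro that[of m]) (simp add: leading_exponent_def)
qed (use assms in simp_all)

lemma leading_exponent_degree:
  "leading_exponent p a \<Longrightarrow> degree_le p (monom_degree a)"
  by (auto simp: leading_exponent_def degree_le_iff monom_degree_le_if_key_le)

lemma leading_exponent_single:
  "c \<noteq> 0 \<Longrightarrow> leading_exponent (Poly_Mapping.single a c) a"
  by (simp add: leading_exponent_def)

lemma lookup_mult_keys:
  "Poly_Mapping.lookup (p * q) c = (\<Sum>x\<in>Poly_Mapping.keys p. \<Sum>y\<in>Poly_Mapping.keys q.
    Poly_Mapping.lookup p x * Poly_Mapping.lookup q y when x + y = c)"
proof -
  have "p * q = (\<Sum>x\<in>Poly_Mapping.keys p. \<Sum>y\<in>Poly_Mapping.keys q.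
      Poly_Mapping.single (x + y) (Poly_Mapping.lookup p x * Poly_Mapping.lookup q y))"
    by (simp only: sum_product[symmetric] mult_single[symmetric] poly_mapping_sum_single)
  then show ?thesis
    by (simp only: lookup_sum lookup_single)
qed

text \<open>Keys are additive and their order is compatible with addition, so a + b arises only from
  the pair (a, b); its coefficient is a product of nonzero elements of a domain.\<close>

lemma leading_exponent_mult:
  fixes p q :: "('n::finite, 'k::idom) mpoly"
  assumes p: "leading_exponent p a" and q: "leading_exponent q b"
  shows "leading_exponent (p * q) (a + b)"
proof -
  have unique: "x + y = a + b \<longleftrightarrow> x = a \<and> y = b"
    if "x \<in> Poly_Mapping.keys p" "y \<in> Poly_Mapping.keys q" for x y
  proof
    assume "x + y = a + b"
    then have eq: "exponent_key x + exponent_key y = exponent_key a + exponent_key b"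
      by (simp flip: exponent_key_add)
    have le: "exponent_key x \<le> exponent_key a" "exponent_key y \<le> exponent_key b"
      using that p q by (auto simp: leading_exponent_def)
    have "exponent_key x = exponent_key a"
      using eq le add_less_le_mono[of "exponent_key x" "exponent_key a" "exponent_key y" "exponent_key b"]
      by (metis less_irrefl order_le_less)
    with \<open>x + y = a + b\<close> show "x = a \<and> y = b" by simp
  qed simp
  have "Poly_Mapping.lookup (p * q) (a + b) =
      (\<Sum>x\<in>Poly_Mapping.keys p. \<Sum>y\<in>Poly_Mapping.keys q.
        if y = b then if x = a then Poly_Mapping.lookup p a * Poly_Mapping.lookup q b else 0 else 0)"
    unfolding lookup_mult_keys using unique
    by (intro sum.cong refl) (auto simp: when_def)
  also have "\<dots> = Poly_Mapping.lookup p a * Poly_Mapping.lookup q b"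
    using p q by (simp add: leading_exponent_def sum.delta)
  finally have "a + b \<in> Poly_Mapping.keys (p * q)"
    using p q by (simp add: leading_exponent_def in_keys_iff)
  moreover have "exponent_key c \<le> exponent_key (a + b)" if c: "c \<in> Poly_Mapping.keys (p * q)" for c
  proof -
    obtain x y where "c = x + y" "x \<in> Poly_Mapping.keys p" "y \<in> Poly_Mapping.keys q"
      using subsetD[OF keys_mult c] by blast
    then show ?thesis
      using p q by (auto simp: exponent_key_add leading_exponent_def intro!: add_mono)
  qed
  ultimately show ?thesis
    by (simp add: leading_exponent_def)
qed

text \<open>The iterate \<open>((+) a ^^ l) b\<close> is the exponent b + l a, in a form suited to
  induction on l.\<close>

lemma leading_exponent_mult_power:
  fixes p q :: "('n::finite, 'k::idom) mpoly"
  assumes "leading_exponent p a" "leading_exponent q b"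
  shows "leading_exponent (q * p ^ l) (((+) a ^^ l) b)"
proof (induction l)
  case (Suc l)
  then have "leading_exponent (p * (q * p ^ l)) (a + ((+) a ^^ l) b)"
    by (rule leading_exponent_mult[OF assms(1)])
  then show ?case by (simp add: mult.left_commute)
qed (simp add: assms)

text \<open>Among the terms with nonzero coefficient, the largest leading exponent occurs in one
  term only and therefore cannot cancel.\<close>

lemma leading_exponents_independent:
  fixes u :: "'i \<Rightarrow> ('n::finite, 'k::idom) mpoly"
  assumes "finite I" "inj_on L I" "\<And>x. x \<in> I \<Longrightarrow> leading_exponent (u x) (L x)"
    and zero: "(\<Sum>x\<in>I. Const (c x) * u x) = 0" and "x \<in> I"
  shows "c x = 0"
proof (rule ccontr)
  define J where "J = {x \<in> I. c x \<noteq> 0}"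
  assume "c x \<noteq> 0"
  then have "finite J" "J \<noteq> {}"
    using assms by (auto simp: J_def)
  then obtain m where m: "m \<in> J"
    and max: "\<And>y. y \<in> J \<Longrightarrow> exponent_key (L y) \<le> exponent_key (L m)"
    using finite_maximal_key[of J "exponent_key \<circ> L"] by auto
  have "L m \<notin> Poly_Mapping.keys (u y)" if "y \<in> J" "y \<noteq> m" for y
  proof
    assume "L m \<in> Poly_Mapping.keys (u y)"
    then have "exponent_key (L m) \<le> exponent_key (L y)"
      using assms(3)[of y] that by (auto simp: leading_exponent_def J_def)
    with max[OF that(1)] have "L m = L y" by simp
    with that m assms(2) show False by (auto simp: J_def inj_on_def)
  qed
  then have "Poly_Mapping.lookup (Const (c y) * u y) (L m) =
      (if y = m then c m * Poly_Mapping.lookup (u m) (L m) else 0)" if "y \<in> I" for y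
    using that by (auto simp: lookup_mult_keys Const_def J_def in_keys_iff when_def sum.delta
        intro!: sum.neutral)
  then have "Poly_Mapping.lookup (\<Sum>x\<in>I. Const (c x) * u x) (L m) =
      (\<Sum>y\<in>I. if y = m then c m * Poly_Mapping.lookup (u m) (L m) else 0)"
    by (simp add: lookup_sum)
  with zero have "c m * Poly_Mapping.lookup (u m) (L m) = 0"
    using m assms(1) by (simp add: J_def sum.delta)
  with m assms(3)[of m] show False
    by (simp add: J_def leading_exponent_def in_keys_iff)
qed

text \<open>Polynomials supported in T lie in the span of the monomials with exponents in T, so this
  is the dimension bound for independent sets. Independence is assumed of an indexed family, hence
  injectivity of v has to be derived.\<close>

lemma card_le_card_exponents:
  fixes v :: "'i \<Rightarrow> ('n::finite, 'k::field) mpoly"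
  assumes "finite I" "finite T" "\<And>x. x \<in> I \<Longrightarrow> Poly_Mapping.keys (v x) \<subseteq> T"
    and indep: "\<And>c x. (\<Sum>x\<in>I. Const (c x) * v x) = 0 \<Longrightarrow> x \<in> I \<Longrightarrow> c x = 0"
  shows "card I \<le> card T"
proof -
  interpret vec: vector_space "\<lambda>c. (*) (Const c :: ('n, 'k) mpoly)"
    by standard (simp_all add: Const_def single_add algebra_simps mult_single)
  have inj: "inj_on v I"
  proof (rule inj_onI, rule ccontr)
    fix x y assume xy: "x \<in> I" "y \<in> I" "v x = v y" "x \<noteq> y"
    \<comment> \<open>A repeated value would give a relation with coefficients 1 and -1.\<close>
    let ?c = "\<lambda>z. if z = x then 1 else if z = y then - 1 else 0"
    have "(\<Sum>z\<in>I. Const (?c z) * v z) = (\<Sum>z\<in>I. (if z = x then v x else 0) + (if z = y then - v x else 0))"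
      using xy by (intro sum.cong refl) (auto simp: Const_def single_uminus)
    also have "\<dots> = 0"
      using xy assms(1) by (simp only: sum.distrib sum.delta) simp
    finally show False
      using indep[of ?c x] xy by simp
  qed
  have "vec.independent (v ` I)"
  proof (rule vec.independent_if_scalars_zero)
    fix f w assume "(\<Sum>w\<in>v ` I. Const (f w) * w) = 0" "w \<in> v ` I"
    then show "f w = 0"
      using indep[of "f \<circ> v"] inj by (auto simp: sum.reindex)
  qed (use assms(1) in simp)
  moreover have "v ` I \<subseteq> vec.span ((\<lambda>a. Poly_Mapping.single a 1) ` T)"
  proof (intro image_subsetI)
    fix x assume x: "x \<in> I"
    have "(\<Sum>a\<in>Poly_Mapping.keys (v x). Const (Poly_Mapping.lookup (v x) a) * Poly_Mapping.single a 1)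
        \<in> vec.span ((\<lambda>a. Poly_Mapping.single a 1) ` T)"
      using assms(3)[OF x] by (intro vec.span_sum vec.span_scale vec.span_base) auto
    then show "v x \<in> vec.span ((\<lambda>a. Poly_Mapping.single a 1) ` T)"
      by (simp add: Const_def mult_single poly_mapping_sum_single)
  qed
  ultimately have "card (v ` I) \<le> card ((\<lambda>a. Poly_Mapping.single a 1 :: ('n, 'k) mpoly) ` T)"
    using vec.independent_span_bound assms(2) by blast
  also have "\<dots> \<le> card T"
    by (rule card_image_le[OF assms(2)])
  finally show ?thesis
    by (simp add: card_image[OF inj])
qed

section \<open>The degree of the inverse\<close>

text \<open>Division with remainder: copies of a are split off while possible, and each one lowers
  the degree because a is nonzero.\<close>

lemma funpow_add_decomposition:
  fixes a b :: "'n::finite \<Rightarrow>\<^sub>0 nat"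
  assumes "a \<noteq> 0"
  shows "\<exists>b q. c = ((+) a ^^ q) b \<and> (\<nexists>b'. b = a + b')"
proof (induction "monom_degree c" arbitrary: c rule: less_induct)
  case less
  show ?case
  proof (cases "\<exists>c'. c = a + c'")
    case True
    then obtain c' where c': "c = a + c'" by blast
    with assms have "monom_degree c' < monom_degree c"
      by (simp add: monom_degree_add monom_degree_pos_iff)
    from less[OF this] obtain b q where "c' = ((+) a ^^ q) b" "\<nexists>b'. b = a + b'" by blast
    then show ?thesis
      using c' by (intro exI[of _ b] exI[of _ "Suc q"]) simp
  next
    case False
    then show ?thesis by (intro exI[of _ c] exI[of _ 0]) simp
  qed
qed

text \<open>Copies of a are cancelled one at a time; if one side ran out first, its remainder would
  be divisible by a.\<close>

lemma funpow_add_unique: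
  fixes a b :: "'a::cancel_comm_monoid_add"
  assumes "((+) a ^^ q) b = ((+) a ^^ q') b'" "\<nexists>c. b = a + c" "\<nexists>c. b' = a + c"
  shows "q = q' \<and> b = b'"
  using assms(1)
proof (induction q arbitrary: q')
  case 0
  with assms(2) show ?case by (cases q') auto
next
  case (Suc q)
  with assms(3) show ?case by (cases q') auto
qed

lemma monom_degree_funpow_add:
  "monom_degree (((+) a ^^ q) b) = q * monom_degree a + monom_degree b"
  by (induction q) (simp_all add: monom_degree_add)

section \<open>Counting exponents of bounded degree\<close>

definition exponents_upto :: "nat \<Rightarrow> ('n::finite \<Rightarrow>\<^sub>0 nat) set"
  where "exponents_upto s = {a. monom_degree a \<le> s}"

lemma lookup_le_monom_degree: "Poly_Mapping.lookup a i \<le> monom_degree a"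
  unfolding monom_degree_def by (rule member_le_sum) auto

text \<open>This embedding into a finite cube yields both finiteness and the polynomial bound on the
  count.\<close>

lemma lookup_exponents_upto:
  "Poly_Mapping.lookup ` exponents_upto s \<subseteq> PiE UNIV (\<lambda>_. {..s})"
proof (rule image_subsetI)
  fix a :: "'a \<Rightarrow>\<^sub>0 nat" assume "a \<in> exponents_upto s"
  then have "Poly_Mapping.lookup a i \<le> s" for i
    using lookup_le_monom_degree[of a i] by (simp add: exponents_upto_def)
  then show "Poly_Mapping.lookup a \<in> PiE UNIV (\<lambda>_. {..s})" by (simp add: PiE_iff)
qed

lemma inj_on_lookup: "inj_on Poly_Mapping.lookup A"
  by (simp add: inj_on_def lookup_inject)

lemma finite_exponents_upto [simp]: "finite (exponents_upto s)"
  by (rule inj_on_finite[OF inj_on_lookup lookup_exponents_upto]) (simp add: finite_PiE)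

lemma card_exponents_upto_le:
  "card (exponents_upto s :: ('n::finite \<Rightarrow>\<^sub>0 nat) set) \<le> (s + 1) ^ CARD('n)"
proof -
  have "card (exponents_upto s :: ('n \<Rightarrow>\<^sub>0 nat) set) \<le> card (PiE (UNIV :: 'n set) (\<lambda>_. {..s}))"
    by (rule card_inj_on_le[OF inj_on_lookup lookup_exponents_upto]) (simp add: finite_PiE)
  then show ?thesis by (simp add: card_PiE)
qed

text \<open>Divide entrywise by D: the quotients form an exponent of degree at most s, and the
  vector of remainders has at most \<open>D ^ CARD('n)\<close> values.\<close>

lemma card_exponents_upto_mult:
  assumes "D > 0"
  shows "card (exponents_upto (D * s) :: ('n::finite \<Rightarrow>\<^sub>0 nat) set) \<le>
    D ^ CARD('n) * card (exponents_upto s :: ('n \<Rightarrow>\<^sub>0 nat) set)"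
proof -
  define f where "f a = (Abs_poly_mapping (\<lambda>i::'n. Poly_Mapping.lookup a i div D),
    \<lambda>i. Poly_Mapping.lookup a i mod D)" for a :: "'n \<Rightarrow>\<^sub>0 nat"
  have "inj f"
  proof (rule injI)
    fix a b assume "f a = f b"
    then have "(\<lambda>i. Poly_Mapping.lookup a i div D) = (\<lambda>i. Poly_Mapping.lookup b i div D)"
      "(\<lambda>i. Poly_Mapping.lookup a i mod D) = (\<lambda>i. Poly_Mapping.lookup b i mod D)"
      by (auto simp: f_def Abs_poly_mapping_inject)
    then have "Poly_Mapping.lookup a i = Poly_Mapping.lookup b i" for i
      by (metis div_mult_mod_eq)
    then show "a = b" by (rule poly_mapping_eqI)
  qed
  moreover have "f ` exponents_upto (D * s) \<subseteq> exponents_upto s \<times> PiE UNIV (\<lambda>_. {..<D})"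
  proof (intro image_subsetI)
    fix a :: "'n \<Rightarrow>\<^sub>0 nat" assume "a \<in> exponents_upto (D * s)"
    then have "(\<Sum>i\<in>UNIV. D * (Poly_Mapping.lookup a i div D)) \<le> D * s"
      using sum_mono[of UNIV "\<lambda>i. D * (Poly_Mapping.lookup a i div D)" "Poly_Mapping.lookup a"]
      by (simp add: exponents_upto_def monom_degree_def)
    then show "f a \<in> exponents_upto s \<times> PiE UNIV (\<lambda>_. {..<D})"
      using assms by (auto simp: f_def exponents_upto_def monom_degree_def simp flip: sum_distrib_left)
  qed
  ultimately have "card (exponents_upto (D * s) :: ('n \<Rightarrow>\<^sub>0 nat) set) \<le>
      card ((exponents_upto s :: ('n \<Rightarrow>\<^sub>0 nat) set) \<times> PiE (UNIV :: 'n set) (\<lambda>_. {..<D}))"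
    by (intro card_inj_on_le[of f]) (auto simp: finite_PiE inj_on_def)
  then show ?thesis
    by (simp add: card_cartesian_product card_PiE mult.commute)
qed

text \<open>Index set of the products X^b (G i)^l; the weight D |b| + l bounds the degree of their
  images F^b (X i)^l.\<close>

definition reduced_pairs :: "nat \<Rightarrow> ('n::finite \<Rightarrow>\<^sub>0 nat) \<Rightarrow> nat \<Rightarrow> (('n \<Rightarrow>\<^sub>0 nat) \<times> nat) set"
  where "reduced_pairs D a k = {(b, l). (\<nexists>c. b = a + c) \<and> D * monom_degree b + l \<le> k}"

lemma finite_reduced_pairs:
  assumes "D > 0"
  shows "finite (reduced_pairs D a k)"
proof (rule finite_subset)
  show "reduced_pairs D a k \<subseteq> exponents_upto k \<times> {..k}"
  proof
    fix x assume "x \<in> reduced_pairs D a k"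
    then obtain b l where x: "x = (b, l)" "D * monom_degree b + l \<le> k"
      by (auto simp: reduced_pairs_def)
    moreover have "monom_degree b \<le> D * monom_degree b" using assms by simp
    ultimately have "monom_degree b \<le> k" "l \<le> k" by linarith+
    with x show "x \<in> exponents_upto k \<times> {..k}" by (simp add: exponents_upto_def)
  qed
qed simp

text \<open>For c = b + q a and t < e, send (c, t) to (b, e q + t). Division by e recovers q and t,
  and the weight of the image is D |c| + t.\<close>

lemma card_reduced_pairs_ge:
  fixes a :: "'n::finite \<Rightarrow>\<^sub>0 nat"
  assumes "a \<noteq> 0" "D > 0"
  shows "card (exponents_upto s :: ('n \<Rightarrow>\<^sub>0 nat) set) * (D * monom_degree a) \<le>
    card (reduced_pairs D a (D * (s + monom_degree a)))"
proof -
  \<comment> \<open>The weight lost when one copy of a is removed from c; the summand e q of the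
    second component restores it.\<close>
  define e where "e = D * monom_degree a"
  have "e > 0"
    using assms by (simp add: e_def monom_degree_pos_iff)
  obtain B Q where BQ: "\<And>c. c = ((+) a ^^ Q c) (B c)" "\<And>c. \<nexists>b'. B c = a + b'"
    using funpow_add_decomposition[OF assms(1)] by metis
  define f where "f = (\<lambda>(c, t). (B c, e * Q c + t))"
  let ?S = "(exponents_upto s :: ('n \<Rightarrow>\<^sub>0 nat) set) \<times> {..<e}"
  have "inj_on f ?S"
  proof (rule inj_onI)
    fix x y assume "x \<in> ?S" "y \<in> ?S" "f x = f y"
    then obtain c t c' t' where xy: "x = (c, t)" "y = (c', t')" "t < e" "t' < e"
      and *: "B c = B c'" "e * Q c + t = e * Q c' + t'"
      by (auto simp: f_def)
    have "Q c = (e * Q c + t) div e" using \<open>t < e\<close> by simp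
    also have "\<dots> = Q c'" using \<open>t' < e\<close> by (simp add: *(2))
    finally have "Q c = Q c'" .
    with * BQ(1)[of c] BQ(1)[of c'] xy show "x = y" by simp
  qed
  moreover have "f ` ?S \<subseteq> reduced_pairs D a (D * (s + monom_degree a))"
  proof (rule image_subsetI)
    fix x assume "x \<in> ?S"
    then obtain c t where x: "x = (c, t)" "c \<in> exponents_upto s" "t < e"
      by auto
    have "monom_degree c = Q c * monom_degree a + monom_degree (B c)"
      using monom_degree_funpow_add[of "Q c" a "B c"] BQ(1)[of c] by simp
    then have "D * monom_degree (B c) + (e * Q c + t) = D * monom_degree c + t"
      by (simp add: e_def algebra_simps)
    also have "\<dots> \<le> D * s + e"
      using x by (intro add_mono mult_left_mono) (auto simp: exponents_upto_def)
    finally show "f x \<in> reduced_pairs D a (D * (s + monom_degree a))"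
      using BQ(2)[of c] x by (simp add: f_def reduced_pairs_def e_def distrib_left)
  qed
  ultimately have "card ?S \<le>
      card (reduced_pairs D a (D * (s + monom_degree a)))"
    using card_inj_on_le finite_reduced_pairs[OF assms(2)] by blast
  then show ?thesis
    by (simp add: card_cartesian_product e_def)
qed

text \<open>Iterating the growth inequality gives p^t \<le> q^t A(t e). If p > q, then A(t e) would
  grow exponentially in t, against its polynomial bound.\<close>

lemma growth_bound:
  fixes A :: "nat \<Rightarrow> nat"
  assumes "A 0 > 0" and poly: "\<And>s. A s \<le> (s + 1) ^ n" and growth: "\<And>s. A s * p \<le> q * A (s + e)"
    and "q > 0"
  shows "p \<le> q"
proof (rule ccontr)
  assume "\<not> p \<le> q"
  \<comment> \<open>Chosen so that (p/q)^t = exp (c t), the form to which the limit of x^n / exp x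
    applies.\<close>
  define c where "c = ln (real p / real q)"
  have "c > 0"
    using \<open>\<not> p \<le> q\<close> \<open>q > 0\<close> by (simp add: c_def)
  have "p ^ t \<le> q ^ t * A (t * e)" for t
  proof (induction t)
    case (Suc t)
    have "p ^ Suc t \<le> q ^ t * (A (t * e) * p)"
      using Suc mult_right_mono[of "p ^ t" _ p] by (simp add: ac_simps)
    also have "\<dots> \<le> q ^ t * (q * A (t * e + e))"
      by (intro mult_left_mono growth) simp
    finally show ?case by (simp add: ac_simps)
  qed (use assms(1) in simp)
  then have "real (p ^ t) \<le> real (q ^ t * A (t * e))" for t
    by (simp only: of_nat_le_iff)
  then have "real p ^ t \<le> real q ^ t * real (A (t * e))" for t
    by simp
  \<comment> \<open>For t \<ge> 1, t e + 1 \<le> t (e + 1), which gives a bound comparable with (c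
    t)^n.\<close>
  moreover have "real (A (t * e)) \<le> real (t * (e + 1)) ^ n" if "t \<ge> 1" for t
  proof -
    have "A (t * e) \<le> (t * (e + 1)) ^ n"
      using poly[of "t * e"] power_mono[of "t * e + 1" "t * (e + 1)" n] that by simp
    then have "real (A (t * e)) \<le> real ((t * (e + 1)) ^ n)"
      by (simp only: of_nat_le_iff)
    then show ?thesis by (simp only: of_nat_power)
  qed
  ultimately have "real p ^ t \<le> real q ^ t * real (t * (e + 1)) ^ n" if "t \<ge> 1" for t
    using that by (meson mult_left_mono of_nat_0_le_iff order_trans zero_le_power)
  moreover have "exp (c * real t) = real p ^ t / real q ^ t" for t
    using \<open>q > 0\<close> \<open>\<not> p \<le> q\<close> by (simp only: c_def exp_of_nat2_mult) (simp add: power_divide)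
  ultimately have exp_le: "exp (c * real t) \<le> real (t * (e + 1)) ^ n" if "t \<ge> 1" for t
    using that \<open>q > 0\<close> by (simp only: pos_divide_le_eq zero_less_power of_nat_0_less_iff mult.commute)
  have "filterlim (\<lambda>t. c * real t) at_top sequentially"
    using \<open>c > 0\<close> by (intro filterlim_tendsto_pos_mult_at_top[OF tendsto_const]
        filterlim_real_sequentially)
  then have "(\<lambda>t. (c * real t) ^ n / exp (c * real t)) \<longlonglongrightarrow> 0"
    by (rule filterlim_compose[OF tendsto_power_div_exp_0])
  \<comment> \<open>The threshold for the limit: after clearing denominators the resulting estimate
    contradicts \<open>exp_le\<close> multiplied by c^n.\<close>
  moreover have "0 < (c / real (e + 1)) ^ n"
    using \<open>c > 0\<close> by simp
  ultimately have "\<forall>\<^sub>F t in sequentially. (c * real t) ^ n / exp (c * real t) < (c / real (e + 1)) ^ n"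
    by (rule order_tendstoD)
  then obtain N where N: "\<And>t. t \<ge> N \<Longrightarrow> (c * real t) ^ n / exp (c * real t) < (c / real (e + 1)) ^ n"
    by (auto simp: eventually_sequentially)
  define t where "t = max 1 N"
  have "(c * real t) ^ n / exp (c * real t) < c ^ n / real (e + 1) ^ n"
    using N[of t] by (simp only: power_divide t_def)
  then have "(c * real t) ^ n * real (e + 1) ^ n < c ^ n * exp (c * real t)"
    by (simp add: divide_simps)
  also have "\<dots> \<le> c ^ n * real (t * (e + 1)) ^ n"
    using exp_le[of t] \<open>c > 0\<close> by (intro mult_left_mono) (simp_all add: t_def)
  also have "\<dots> = (c * real t) ^ n * real (e + 1) ^ n"
    by (simp only: of_nat_mult power_mult_distrib mult.assoc)
  finally show False by blast
qed

text \<open>Keys compare degrees first, so it is enough to bound the degree of the leading exponent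
  a of G i; this is the dimension count.\<close>

lemma inverse_degree_bound:
  fixes F G :: "'n::finite \<Rightarrow> ('n, 'k::field) mpoly"
  assumes F1: "\<And>i. lower_degree_ge (F i) 1" and F2: "\<And>i. lower_degree_ge (F i - X i) 2"
    and deg: "\<And>i. degree_le (F i) D" and "D > 0" and "is_inverse F G"
  shows "degree_le (G i) (D ^ (CARD('n) - 1))"
proof -
  have GF: "subst_poly (G i) F = X i"
    using \<open>is_inverse F G\<close> by (simp add: is_inverse_def)
  have "G i \<noteq> 0"
  proof
    assume "G i = 0"
    with GF have "Poly_Mapping.lookup (X i :: ('n, 'k) mpoly) (Poly_Mapping.single i 1) = 0" by simp
    then show False by (simp add: X_def)
  qed
  then obtain a where a: "leading_exponent (G i) a"
    by (rule leading_exponent_exists)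
  have "monom_degree a \<le> D ^ (CARD('n) - 1)"
  proof (cases "a = 0")
    case False
    let ?A = "\<lambda>s. card (exponents_upto s :: ('n \<Rightarrow>\<^sub>0 nat) set)"
    let ?e = "monom_degree a"
    \<comment> \<open>The degree is controlled after substitution of F, whereas independence is
      visible before it, from the leading exponents b + l a.\<close>
    have pairs: "card (reduced_pairs D a k) \<le> ?A k" for k
    proof -
      let ?u = "\<lambda>(b, l). Poly_Mapping.single b 1 * G i ^ l"
      let ?v = "\<lambda>(b, l). monomial_at F b * X i ^ l"
      have v: "?v x = subst_poly (?u x) F" for x
        by (cases x) (simp add: subst_poly_mult subst_poly_power subst_poly_single GF Const_def)
      show ?thesis
      proof (rule card_le_card_exponents[where v = ?v])
        show "finite (reduced_pairs D a k)"
          using \<open>D > 0\<close> by (rule finite_reduced_pairs)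
        show "Poly_Mapping.keys (?v x) \<subseteq> exponents_upto k" if "x \<in> reduced_pairs D a k" for x
        proof -
          obtain b l where x: "x = (b, l)" by (cases x)
          have "degree_le (monomial_at F b * X i ^ l) (D * monom_degree b + l * 1)"
            by (intro degree_le_mult degree_le_monomial_at degree_le_power deg degree_le_X)
          then have "degree_le (?v x) k"
            using that x degree_le_mono by (auto simp: reduced_pairs_def)
          then show ?thesis
            by (auto simp: degree_le_iff exponents_upto_def)
        qed
        show "c x = 0"
          if "(\<Sum>x\<in>reduced_pairs D a k. Const (c x) * ?v x) = 0" "x \<in> reduced_pairs D a k" for c x
        proof (rule leading_exponents_independent[where u = ?u])
          show "inj_on (\<lambda>(b, l). ((+) a ^^ l) b) (reduced_pairs D a k)"
            by (auto simp: inj_on_def reduced_pairs_def dest!: funpow_add_unique)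
          show "leading_exponent (?u x) ((\<lambda>(b, l). ((+) a ^^ l) b) x)" for x
            by (cases x) (simp add: leading_exponent_mult_power a leading_exponent_single)
          \<comment> \<open>A relation among the images pulls back because substitution of F is
            injective.\<close>
          have "subst_poly (\<Sum>x\<in>reduced_pairs D a k. Const (c x) * ?u x) F = 0"
            using that(1) by (simp add: subst_poly_sum subst_poly_mult v)
          then show "(\<Sum>x\<in>reduced_pairs D a k. Const (c x) * ?u x) = 0"
            by (simp only: subst_poly_eq_0_iff[OF F1 F2])
        qed (use that(2) finite_reduced_pairs[OF \<open>D > 0\<close>] in simp_all)
      qed simp
    qed
    \<comment> \<open>\<open>growth_bound\<close> with p = D |a| and q = D^n; cancelling one factor
      D then leaves the exponent n - 1.\<close>
    have "D * ?e \<le> D ^ CARD('n)"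
    proof (rule growth_bound)
      show "?A s * (D * ?e) \<le> D ^ CARD('n) * ?A (s + ?e)" for s
        using card_reduced_pairs_ge[OF False \<open>D > 0\<close>, of s] pairs[of "D * (s + ?e)"]
          card_exponents_upto_mult[OF \<open>D > 0\<close>, of "s + ?e", where 'n = 'n] by linarith
      have "(0 :: 'n \<Rightarrow>\<^sub>0 nat) \<in> exponents_upto 0"
        by (simp add: exponents_upto_def)
      then show "?A 0 > 0"
        by (auto simp: card_gt_0_iff)
      show "?A s \<le> (s + 1) ^ CARD('n)" for s
        by (rule card_exponents_upto_le)
    qed (use \<open>D > 0\<close> in simp)
    also have "D ^ CARD('n) = D * D ^ (CARD('n) - 1)"
      by (rule power_eq_if[THEN trans]) simp
    finally show ?thesis
      using \<open>D > 0\<close> by simp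
  qed simp
  with leading_exponent_degree[OF a] show ?thesis
    by (rule degree_le_mono)
qed

section \<open>Alternating sums of the polynomial sequence\<close>

lemma truncate_degree_add: "truncate_degree b (p + q) = truncate_degree b p + truncate_degree b q"
  by (rule poly_mapping_eqI) (simp add: lookup_truncate_degree lookup_add when_add_distrib)

lemma truncate_degree_uminus:
  fixes p :: "('n::finite, 'k::ab_group_add) mpoly"
  shows "truncate_degree b (- p) = - truncate_degree b p"
  by (rule poly_mapping_eqI) (simp add: lookup_truncate_degree when_def)

lemma truncate_degree_zero [simp]: "truncate_degree b 0 = 0"
  by (rule poly_mapping_eqI) (simp add: lookup_truncate_degree)

lemma truncate_degree_alternating_sum:
  fixes p :: "nat \<Rightarrow> ('n::finite, 'k::comm_ring_1) mpoly"
  shows "truncate_degree b (\<Sum>l<m. (- 1) ^ l * p l) = (\<Sum>l<m. (- 1) ^ l * truncate_degree b (p l))"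
proof (induction m)
  case (Suc m)
  have "truncate_degree b ((- 1) ^ m * p m) = (- 1) ^ m * truncate_degree b (p m)"
    by (cases "even m") (simp_all add: truncate_degree_uminus)
  with Suc show ?case by (simp add: truncate_degree_add)
qed simp

lemma truncate_degree_id: "degree_le p b \<Longrightarrow> truncate_degree b p = p"
  by (rule poly_mapping_eqI) (auto simp: lookup_truncate_degree degree_le_iff when_def in_keys_iff)

lemma truncate_degree_eq_0: "lower_degree_ge p c \<Longrightarrow> b < c \<Longrightarrow> truncate_degree b p = 0"
  by (rule poly_mapping_eqI)
     (force simp: lookup_truncate_degree lower_degree_ge_iff when_def in_keys_iff)

text \<open>Since P_j(F) = P_j + P_(j+1), the sum telescopes. The sign exponent m + 1 also fits m =
  0, where both sides vanish.\<close>

lemma subst_poly_alternating_sum: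
  "subst_poly (\<Sum>j<m. (- 1) ^ j * P_seq F i j) F = X i + (- 1) ^ (m + 1) * P_seq F i m"
  by (induction m)
     (simp_all add: subst_poly_add subst_poly_mult subst_poly_power subst_poly_uminus algebra_simps)

text \<open>Substituting F and comparing with the telescoped sum cancels the remainder. Both
  converse directions rest on this.\<close>

lemma is_inverse_component_if_alternating_sum_eq:
  assumes "(\<Sum>j<m. (- 1) ^ j * P_seq F i j) = G + R"
    and "subst_poly R F = (- 1) ^ (m + 1) * P_seq F i m"
  shows "X i = subst_poly G F"
  using subst_poly_alternating_sum[of F i m] assms by (simp add: subst_poly_add)

text \<open>The estimate starts at R 1 = X i - G i = H i (G), of lower degree at least s i; each
  step R (m + 1) = - \<Delta> (R m) then gains d - 1.\<close>

lemma alternating_sum_remainder: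
  fixes F H G :: "'n::finite \<Rightarrow> ('n, 'k::comm_ring_1) mpoly"
  assumes F: "\<And>i. F i = X i + H i" and H: "\<And>i. lower_degree_ge (H i) (s i)"
    and s: "\<And>i. d \<le> s i" and "2 \<le> d" and inv: "is_inverse F G"
  defines "R \<equiv> \<lambda>i m. (\<Sum>j<m. (- 1) ^ j * P_seq F i j) - G i"
  shows "subst_poly (R i m) F = (- 1) ^ (m + 1) * P_seq F i m"
    and "lower_degree_ge (R i (Suc m)) (m * (d - 1) + s i)"
proof -
  have H_d: "lower_degree_ge (F i - X i) d" for i
    using lower_degree_ge_mono[OF H s] by (simp add: F)
  then have F2: "lower_degree_ge (F i - X i) 2" for i
    using lower_degree_ge_mono \<open>2 \<le> d\<close> by blast
  have F1: "lower_degree_ge (F i) 1" for i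
  proof -
    have "lower_degree_ge (X i + (F i - X i)) 1"
      by (intro lower_degree_ge_add lower_degree_ge_X lower_degree_ge_mono[OF F2]) simp
    then show ?thesis by simp
  qed
  have increment: "lower_degree_ge (subst_poly Q F - Q) (t + (d - 1))" if "lower_degree_ge Q t" for Q t
    using F1 H_d that \<open>2 \<le> d\<close> by (intro lower_degree_ge_subst_poly_diff) simp_all
  have GF: "subst_poly (G i) F = X i" for i
    using inv by (simp add: is_inverse_def)
  show RF: "subst_poly (R i m) F = (- 1) ^ (m + 1) * P_seq F i m" for m
    by (simp add: R_def subst_poly_diff subst_poly_alternating_sum GF)
  \<comment> \<open>X i - G i = G i (F) - G i has no constant term, hence neither has G i;
    substitution of G therefore preserves lower degree bounds.\<close>
  have G1: "lower_degree_ge (G i) 1" for i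
  proof -
    have "lower_degree_ge (X i - G i) 1"
      using increment[of "G i" 0] \<open>2 \<le> d\<close> by (auto simp: GF intro: lower_degree_ge_mono)
    then have "lower_degree_ge (X i + - (X i - G i)) 1"
      by (intro lower_degree_ge_add lower_degree_ge_uminus lower_degree_ge_X)
    then show ?thesis by simp
  qed
  \<comment> \<open>Substitution of F turns the expression into F i - X i - H i; injectivity then
    gives X i - G i = H i (G).\<close>
  have "subst_poly (X i - G i - subst_poly (H i) G) F = 0" for i
    by (simp add: subst_poly_diff subst_poly_subst_poly GF) (simp add: F)
  then have XG: "X i - G i = subst_poly (H i) G" for i
    by (simp add: subst_poly_eq_0_iff[OF F1 F2])
  show "lower_degree_ge (R i (Suc m)) (m * (d - 1) + s i)"
  proof (induction m)
    case 0
    then show ?case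
      by (simp add: R_def XG lower_degree_ge_subst_poly[OF G1 H])
  next
    case (Suc m)
    \<comment> \<open>Passing from R m to R (m + 1) adds (-1)^m P_m, which by \<open>RF\<close> is
      -R m (F).\<close>
    have "R i (Suc (Suc m)) = - (subst_poly (R i (Suc m)) F - R i (Suc m))"
      unfolding RF by (simp add: R_def)
    with lower_degree_ge_uminus[OF increment[OF Suc]] show ?case
      by (simp only: mult_Suc add_ac)
  qed
qed

section \<open>The equivalences and the formula for the inverse\<close>

lemma lower_degree_le_total_degree:
  assumes "p \<noteq> 0"
  shows "lower_degree p \<le> total_degree p"
proof -
  obtain a where "a \<in> Poly_Mapping.keys p"
    using assms keys_eq_empty by blast
  then show ?thesis
    unfolding lower_degree_def total_degree_def hom_summands_nonzero
    by (intro order_trans[OF Min_le Max_ge, of _ "monom_degree a"]) simp_all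
qed

theorem theorem8:
  fixes F H :: "'n::finite \<Rightarrow> ('n, 'k::field_char_0) mpoly"
    and Ds ds :: "'n \<Rightarrow> nat"
    and D d :: nat
    and bound :: "'n \<Rightarrow> real"
  assumes F: "\<And>i. F i = X i + H i"
    and H_nonzero: "\<And>i. H i \<noteq> 0"
    and H_degree: "\<And>i. total_degree (H i) = Ds i"
    and H_lower_degree: "\<And>i. lower_degree (H i) = ds i"
    and ds_ge_2: "\<And>i. ds i \<ge> 2"
    and d: "d = Min (range ds)"
    and D: "D = Max (range Ds)"
    and bound: "\<And>i. bound i =
          (real D ^ (CARD('n) - 1) - real (ds i)) / (real d - 1) + 1"
  shows
    "(invertible_map F \<longleftrightarrow>
        (\<forall>i. \<exists>G. degree_le G (D ^ (CARD('n) - 1)) \<and>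
          (\<forall>m::nat. real m > bound i \<longrightarrow>
            (\<exists>R. (\<Sum>j<m. (- 1) ^ j * P_seq F i j) = G + R
               \<and> subst_poly R F = (- 1) ^ (m + 1) * P_seq F i m
               \<and> lower_degree_ge R ((m - 1) * (d - 1) + ds i)
               \<and> (m - 1) * (d - 1) + ds i > D ^ (CARD('n) - 1)))))
     \<and>
     (invertible_map F \<longleftrightarrow>
        (\<forall>i. \<forall>m::nat. int m = \<lfloor>bound i\<rfloor> + 1 \<longrightarrow>
          (\<exists>G R. (\<Sum>j<m. (- 1) ^ j * P_seq F i j) = G + R
             \<and> degree_le G (D ^ (CARD('n) - 1))
             \<and> subst_poly R F = (- 1) ^ (m + 1) * P_seq F i m)))
     \<and>
     (\<forall>G. is_inverse F G \<longrightarrow>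
        (\<forall>i. \<forall>m::nat. real m > bound i \<longrightarrow>
          G i = (\<Sum>l<m. (- 1) ^ l * truncate_degree (D ^ (CARD('n) - 1)) (P_seq F i l))))"
proof -
  let ?N = "D ^ (CARD('n) - 1)"
  let ?S = "\<lambda>i m. \<Sum>j<m. (- 1) ^ j * P_seq F i j"
  have d_le: "d \<le> ds i" and Ds_le: "Ds i \<le> D" for i
    by (simp_all add: d D)
  have "d \<in> range ds"
    unfolding d by (rule Min_in) simp_all
  with ds_ge_2 have "2 \<le> d"
    by auto
  have ds_le: "ds i \<le> D" for i
    using lower_degree_le_total_degree[OF H_nonzero[of i]] Ds_le[of i] H_degree H_lower_degree
    by simp
  then have "2 \<le> D"
    using ds_ge_2 order_trans by blast
  \<comment> \<open>Makes every admissible m at least 1, so that \<open>m - 1\<close> is genuine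
    subtraction, and guarantees that the natural number m of condition 3 exists.\<close>
  have bound_nonneg: "0 \<le> bound i" for i
  proof -
    have "real (ds i) \<le> real D ^ (CARD('n) - 1) + (real d - 1)"
    \<comment> \<open>For n = 1 the power of D is 1 and ds i = d, which gives equality; otherwise ds
      i \<le> D \<le> D^(n-1).\<close>
    proof (cases "CARD('n) = 1")
      case True
      then obtain x :: 'n where "UNIV = {x}"
        by (rule card_1_singletonE)
      with \<open>d \<in> range ds\<close> have "ds i = d"
        by (metis UNIV_I rangeE singletonD)
      with True show ?thesis by simp
    next
      case False
      moreover have "CARD('n) > 0" by simp
      ultimately have "CARD('n) - 1 \<ge> 1" by linarith
      then have "D ^ 1 \<le> ?N"
        using \<open>2 \<le> D\<close> by (intro power_increasing) auto
      with ds_le[of i] have "real (ds i) \<le> real ?N"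
        by (simp only: of_nat_le_iff power_one_right)
      moreover have "1 \<le> real d"
        using \<open>2 \<le> d\<close> by simp
      ultimately show ?thesis
        unfolding of_nat_power by linarith
    qed
    with \<open>2 \<le> d\<close> show ?thesis
      by (simp add: bound divide_simps)
  qed
  have m_bound: "m \<ge> 1" "?N < (m - 1) * (d - 1) + ds i" if "real m > bound i" for m i
  proof -
    show "m \<ge> 1"
      using that bound_nonneg[of i] by simp
    have "(real ?N - real (ds i)) / (real d - 1) < real m - 1"
      using that by (simp add: bound)
    then have "real ?N - real (ds i) < (real m - 1) * (real d - 1)"
      using \<open>2 \<le> d\<close> by (simp add: divide_simps)
    also have "\<dots> = real ((m - 1) * (d - 1))"
      using \<open>m \<ge> 1\<close> \<open>2 \<le> d\<close> by (simp add: of_nat_diff)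
    finally have "real ?N < real ((m - 1) * (d - 1) + ds i)"
      by simp
    then show "?N < (m - 1) * (d - 1) + ds i"
      by (simp only: of_nat_less_iff)
  qed
  have H_ge: "lower_degree_ge (H i) (ds i)" for i
    by (simp add: lower_degree_ge_def H_lower_degree)
  have degree_inverse: "degree_le (G i) ?N" if "is_inverse F G" for G i
  proof (rule inverse_degree_bound[OF _ _ _ _ that])
    show "lower_degree_ge (F i - X i) 2" for i
      using lower_degree_ge_mono[OF H_ge ds_ge_2] by (simp add: F)
    show "lower_degree_ge (F i) 1" for i
      unfolding F using ds_ge_2[of i]
      by (intro lower_degree_ge_add lower_degree_ge_X lower_degree_ge_mono[OF H_ge]) simp
    have "degree_le (H i) D" for i
      using Ds_le by (simp add: degree_le_def H_degree)
    then show "degree_le (F i) D" for i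
      unfolding F using \<open>2 \<le> D\<close>
      by (intro degree_le_add degree_le_mono[OF degree_le_X]) simp_all
  qed (use \<open>2 \<le> D\<close> in simp)
  \<comment> \<open>The lower degree estimate for R is stated at successors, hence the appeal to m
    \<ge> 1.\<close>
  have decomposition: "?S i m = G i + (?S i m - G i)"
      "subst_poly (?S i m - G i) F = (- 1) ^ (m + 1) * P_seq F i m"
      "lower_degree_ge (?S i m - G i) ((m - 1) * (d - 1) + ds i)"
    if "is_inverse F G" "real m > bound i" for G i m
    using alternating_sum_remainder[OF F H_ge d_le \<open>2 \<le> d\<close> that(1), of i] m_bound(1)[OF that(2)]
    by (auto simp: Suc_le_eq gr0_conv_Suc)
  have cond_2: "\<forall>i. \<exists>G. degree_le G ?N \<and> (\<forall>m::nat. real m > bound i \<longrightarrow>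
      (\<exists>R. ?S i m = G + R \<and> subst_poly R F = (- 1) ^ (m + 1) * P_seq F i m
         \<and> lower_degree_ge R ((m - 1) * (d - 1) + ds i) \<and> (m - 1) * (d - 1) + ds i > ?N))"
    if invertible: "invertible_map F"
  proof
    fix i
    obtain G where G: "is_inverse F G"
      using invertible by (auto simp: invertible_map_def)
    have "\<exists>R. ?S i m = G i + R \<and> subst_poly R F = (- 1) ^ (m + 1) * P_seq F i m
         \<and> lower_degree_ge R ((m - 1) * (d - 1) + ds i) \<and> (m - 1) * (d - 1) + ds i > ?N"
      if "real m > bound i" for m
      using decomposition[OF G that] m_bound(2)[OF that] by (intro exI[of _ "?S i m - G i"] conjI)
    then show "\<exists>G. degree_le G ?N \<and> (\<forall>m::nat. real m > bound i \<longrightarrow>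
      (\<exists>R. ?S i m = G + R \<and> subst_poly R F = (- 1) ^ (m + 1) * P_seq F i m
         \<and> lower_degree_ge R ((m - 1) * (d - 1) + ds i) \<and> (m - 1) * (d - 1) + ds i > ?N))"
      using degree_inverse[OF G, of i] by (intro exI[of _ "G i"]) simp
  qed
  \<comment> \<open>The 1 added to the floor makes the inequality strict, so condition 3 is an
    instance of condition 2.\<close>
  have floor_bound: "real m > bound i" if "int m = \<lfloor>bound i\<rfloor> + 1" for m i
    using that by linarith
  \<comment> \<open>At any m above the bound, which exists by the Archimedean property, the
    decomposition gives a component of an inverse.\<close>
  have inverse_2: "invertible_map F"
    if "\<forall>i. \<exists>G. \<forall>m::nat. real m > bound i \<longrightarrow>
      (\<exists>R. ?S i m = G + R \<and> subst_poly R F = (- 1) ^ (m + 1) * P_seq F i m)"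
  proof -
    have "\<exists>G. X i = subst_poly G F" for i
    proof -
      obtain m :: nat where "real m > bound i"
        using reals_Archimedean2 by blast
      with that obtain G R where "?S i m = G + R"
        "subst_poly R F = (- 1) ^ (m + 1) * P_seq F i m" by blast
      then show ?thesis
        using is_inverse_component_if_alternating_sum_eq by blast
    qed
    then show ?thesis
      unfolding invertible_map_def is_inverse_def by metis
  qed
  have inverse_3: "invertible_map F"
    if "\<forall>i. \<forall>m::nat. int m = \<lfloor>bound i\<rfloor> + 1 \<longrightarrow>
      (\<exists>G R. ?S i m = G + R \<and> subst_poly R F = (- 1) ^ (m + 1) * P_seq F i m)"
  proof -
    have "\<exists>G. X i = subst_poly G F" for i
    proof -
      \<comment> \<open>The conversion is exact by \<open>bound_nonneg\<close>; for a negative value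
        condition 3 would hold vacuously.\<close>
      define m where "m = nat (\<lfloor>bound i\<rfloor> + 1)"
      have "int m = \<lfloor>bound i\<rfloor> + 1"
        using bound_nonneg[of i] by (simp add: m_def)
      with that obtain G R where "?S i m = G + R"
        "subst_poly R F = (- 1) ^ (m + 1) * P_seq F i m" by blast
      then show ?thesis
        using is_inverse_component_if_alternating_sum_eq by blast
    qed
    then show ?thesis
      unfolding invertible_map_def is_inverse_def by metis
  qed
  \<comment> \<open>Truncation fixes G i by the degree bound and kills the remainder, whose lower
    degree exceeds D^(n-1).\<close>
  have formula: "G i = (\<Sum>l<m. (- 1) ^ l * truncate_degree ?N (P_seq F i l))"
    if "is_inverse F G" "real m > bound i" for G i m
  proof -
    have "truncate_degree ?N (?S i m) = truncate_degree ?N (G i) + truncate_degree ?N (?S i m - G i)"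
      by (simp flip: truncate_degree_add)
    also have "\<dots> = G i"
      using truncate_degree_id[OF degree_inverse[OF that(1)]]
        truncate_degree_eq_0[OF decomposition(3)[OF that] m_bound(2)[OF that(2)]] by simp
    finally show ?thesis
      by (simp add: truncate_degree_alternating_sum)
  qed
  show ?thesis
  proof (intro conjI)
    show "invertible_map F \<longleftrightarrow>
        (\<forall>i. \<exists>G. degree_le G ?N \<and>
          (\<forall>m::nat. real m > bound i \<longrightarrow>
            (\<exists>R. ?S i m = G + R
               \<and> subst_poly R F = (- 1) ^ (m + 1) * P_seq F i m
               \<and> lower_degree_ge R ((m - 1) * (d - 1) + ds i)
               \<and> (m - 1) * (d - 1) + ds i > ?N)))"
      by (rule iffI[OF cond_2 inverse_2]) (assumption, meson)
    show "invertible_map F \<longleftrightarrow>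
        (\<forall>i. \<forall>m::nat. int m = \<lfloor>bound i\<rfloor> + 1 \<longrightarrow>
          (\<exists>G R. ?S i m = G + R
             \<and> degree_le G ?N
             \<and> subst_poly R F = (- 1) ^ (m + 1) * P_seq F i m))"
    proof
      assume "invertible_map F"
      then show "\<forall>i. \<forall>m::nat. int m = \<lfloor>bound i\<rfloor> + 1 \<longrightarrow>
          (\<exists>G R. ?S i m = G + R
             \<and> degree_le G ?N
             \<and> subst_poly R F = (- 1) ^ (m + 1) * P_seq F i m)"
        using cond_2 floor_bound by meson
    qed (rule inverse_3, meson)
    show "\<forall>G. is_inverse F G \<longrightarrow> (\<forall>i. \<forall>m::nat. real m > bound i \<longrightarrow>
          G i = (\<Sum>l<m. (- 1) ^ l * truncate_degree ?N (P_seq F i l)))"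
      using formula by blast
  qed
qed

end
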